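(* Let $C$ be a row-finite $\omega\times\omega$ matrix over a field $\mathcal F$, let $L=(L_k)_{k\in\omega}$ be the row-finite matrix resulting from $C$ by the infinite Gauss-Jordan algorithm with rightmost pivots, and let $\mathbf L=(\mathbf l_k)_{k\in\omega}$ be the companion sequence obtained by applying the same row operations to the canonical basis of $\mathcal F^{(\omega)}$. Then: (i) The set of nonzero rows of $L$ is a complete basis of row-length of $\mathrm{RS}(C)$. (ii) $L$ is row equivalent to $C$. (iii) $\mathbf L$ is a basis of $\mathcal F^{(\omega)}$.
   Context: $\omega=\{0,1,2,\dots\}$. $\mathcal F$ is a field and $\mathcal F^{(\omega)}$ is the space of sequences in $\mathcal F$ with finitely many nonzero terms, with canonical basis $(\mathbf e_i)_{i\in\omega}$. A row-finite $\omega\times\omega$ matrix is a sequence $C=(C_n)_{n\in\omega}$ of rows $C_n\in\mathcal F^{(\omega)}$; these matrices form an algebra under the usual matrix multiplication. $\mathrm{RS}(A)$ is the span of the rows of $A$. $A$ and $B$ are row equivalent if $Q\cdot A=B$ for some row-finite $Q$ having a two-sided row-finite inverse. For nonzero $x\in\mathcal F^{(\omega)}$ the length $\ell(x)$ is the largest index $i$ with $x_i\ne0$; $\ell(\mathbf 0)=-1$. For a set or family $X$ of vectors, $\mathfrak R(X)$ is the set of lengths of the nonzero members of $X$. A complete basis of row-length (= of rightmost index) of a subspace $\mathcal Z$ of $\mathcal F^{(\omega)}$ is a Hamel basis $\mathbf F$ of $\mathcal Z$ with $\mathfrak R(\mathbf F)=\mathfrak R(\mathcal Z)$. Infinite Gauss-Jordan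 algorithm with rightmost pivots applied to $C$. It produces vectors $L^{(i)}_n\in\mathcal F^{(\omega)}$ (entries $l^{(i)}_{nj}$) for $n\in\omega$, $i\ge -1$, and $G_n=L^{(n)}_n$, stage by stage for $n=0,1,2,\dots$. Stage $n$ uses the vectors $L^{(n-1)}_0,\dots,L^{(n-1)}_{n-1}$ of the previous stage: (1) Gaussian elimination: $L^{(-1)}_n=C_n$; for $i=0,1,\dots,n-1$ in this order, $L^{(i)}_n=L^{(i-1)}_n-l^{(i-1)}_{n\rho_i}L^{(n-1)}_i$ with $\rho_i=\ell(L^{(n-1)}_i)$ if $L^{(n-1)}_i\ne\mathbf 0$, and $L^{(i)}_n=L^{(i-1)}_n$ if $L^{(n-1)}_i=\mathbf 0$. (2) Normalization: $L^{(n)}_n=G_n$, where $G_n$ is $L^{(n-1)}_n$ divided by its rightmost nonzero entry if $L^{(n-1)}_n\neq\mathbf 0$, and $G_n=\mathbf 0$ otherwise. (3) Jordan elimination: for $0\le i\le n-1$, $L^{(n)}_i=L^{(n-1)}_i-l^{(n-1)}_{i\rho_n}G_n$ with $\rho_n=\ell(G_n)$ if $G_n\neq\mathbf 0$, and $L^{(n)}_i=L^{(n-1)}_i$ if $G_n=\mathbf 0$. For each $k$ the sequence $(L^{(n)}_k)_{n\ge k}$ is eventually constant. Let $M_k$ be the smallest integer $\ge k$ with $L^{(n)}_k=L^{(M_k)}_k$ for all $n\ge M_k$, and put $L_k=L^{(M_k)}_k$. Companion vectors: let $E^{(-1)}_n=\mathbf e_n$ and define $E^{(i)}_n$ by performing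 on the $E$'s exactly the same operations with the same scalars (determined by the $L$'s) as those performed on the $L$'s: $E^{(i)}_n=E^{(i-1)}_n-l^{(i-1)}_{n\rho_i}E^{(n-1)}_i$ in (1) if $L^{(n-1)}_i\neq\mathbf 0$ (otherwise unchanged); in (2), $E^{(n)}_n$ is $E^{(n-1)}_n$ divided by the rightmost nonzero entry of $L^{(n-1)}_n$ if $L^{(n-1)}_n\ne\mathbf 0$, and $E^{(n)}_n=E^{(n-1)}_n$ otherwise; in (3), $E^{(n)}_i=E^{(n-1)}_i-l^{(n-1)}_{i\rho_n}E^{(n)}_n$ if $G_n\ne\mathbf 0$ (otherwise unchanged). Put $\mathbf l_k=E^{(M_k)}_k$. *)

theory Defs
  imports Complex_Main "HOL-Library.Poly_Mapping"
begin

text \<open>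
  The space of finitely supported sequences over a field is the type \<open>nat \<Rightarrow>\<^sub>0 'a\<close>;
  a row-finite matrix is the sequence of its rows, of type \<open>nat \<Rightarrow> nat \<Rightarrow>\<^sub>0 'a\<close>,
  with entries \<open>Poly_Mapping.lookup (A n) j\<close>.
\<close>

type_synonym 'a finseq = "nat \<Rightarrow>\<^sub>0 'a"
type_synonym 'a rfmat = "nat \<Rightarrow> 'a finseq"

definition scale :: "'a::field \<Rightarrow> 'a finseq \<Rightarrow> 'a finseq" where
  "scale c x = Poly_Mapping.map (\<lambda>a. c * a) x"

lemma lookup_scale [simp]: "Poly_Mapping.lookup (scale c x) i = c * Poly_Mapping.lookup x i"
  by (simp add: scale_def Poly_Mapping.map.rep_eq when_def)

global_interpretation finseq: vector_space "scale :: 'a::field \<Rightarrow> 'a finseq \<Rightarrow> 'a finseq"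
  by unfold_locales (auto intro!: poly_mapping_eqI simp: lookup_add algebra_simps)

definition unit_vec :: "nat \<Rightarrow> 'a::field finseq" where
  "unit_vec i = Poly_Mapping.single i 1"


subsection \<open>Row-finite matrices\<close>

definition rf_mult :: "'a::field rfmat \<Rightarrow> 'a rfmat \<Rightarrow> 'a rfmat" where
  "rf_mult A B = (\<lambda>n. \<Sum>k\<in>Poly_Mapping.keys (A n). scale (Poly_Mapping.lookup (A n) k) (B k))"

text \<open>The rows of the identity matrix are the \<open>unit_vec n\<close>.\<close>

definition row_equivalent :: "'a::field rfmat \<Rightarrow> 'a rfmat \<Rightarrow> bool" where
  "row_equivalent A B \<longleftrightarrow>
    (\<exists>Q R. rf_mult Q R = unit_vec \<and> rf_mult R Q = unit_vec \<and> rf_mult Q A = B)"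

definition row_space :: "'a::field rfmat \<Rightarrow> 'a finseq set" where
  "row_space A = finseq.span (range A)"


subsection \<open>Lengths and bases\<close>

definition len :: "'a::field finseq \<Rightarrow> int" where
  "len x = (if x = 0 then - 1 else int (Max (Poly_Mapping.keys x)))"

definition lengths :: "'a::field finseq set \<Rightarrow> int set" where
  "lengths X = len ` (X - {0})"

definition is_basis :: "'a::field finseq set \<Rightarrow> 'a finseq set \<Rightarrow> bool" where
  "is_basis F Z \<longleftrightarrow> finseq.independent F \<and> finseq.span F = Z"

definition is_basis_family :: "(nat \<Rightarrow> 'a::field finseq) \<Rightarrow> 'a finseq set \<Rightarrow> bool" where
  "is_basis_family b Z \<longleftrightarrow> inj b \<and> is_basis (range b) Z"

definition complete_length_basis :: "'a::field finseq set \<Rightarrow> 'a finseq set \<Rightarrow> bool" where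
  "complete_length_basis F Z \<longleftrightarrow> is_basis F Z \<and> lengths F = lengths Z"


subsection \<open>Infinite Gauss-Jordan elimination with rightmost pivots\<close>

definition pivot :: "'a::field finseq \<Rightarrow> nat" where
  "pivot x = nat (len x)"  \<comment> \<open>only meaningful, and only used, for \<open>x \<noteq> 0\<close>\<close>

text \<open>
  The superscripts, which start at \<open>-1\<close>, are shifted by one: \<open>gj C n s\<close> is
  $L^{(s-1)}_n$, so that $L^{(i)}_n$ is \<open>gj C n (Suc i)\<close> and $L^{(n-1)}_i$ is \<open>gj C i n\<close>.
  In the second equation the case \<open>i < n\<close> is the Gaussian elimination in stage \<open>n\<close>,
  \<open>i = n\<close> is the normalization in stage \<open>n\<close>, and \<open>i > n\<close> is the Jordan elimination
  of row \<open>n\<close> in stage \<open>i\<close>, where \<open>gj C i (Suc i)\<close> is $G_i$.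
\<close>

function gj :: "'a::field rfmat \<Rightarrow> nat \<Rightarrow> nat \<Rightarrow> 'a finseq" where
  "gj C n 0 = C n"
| "gj C n (Suc i) =
    (if i < n then
       (if gj C i n \<noteq> 0
        then gj C n i - scale (Poly_Mapping.lookup (gj C n i) (pivot (gj C i n))) (gj C i n)
        else gj C n i)
     else if i = n then
       (if gj C n n \<noteq> 0
        then scale (inverse (Poly_Mapping.lookup (gj C n n) (pivot (gj C n n)))) (gj C n n)
        else 0)
     else
       (if gj C i (Suc i) \<noteq> 0
        then gj C n i - scale (Poly_Mapping.lookup (gj C n i) (pivot (gj C i (Suc i)))) (gj C i (Suc i))
        else gj C n i))"
  by pat_completeness auto
termination
  by (relation "measures [\<lambda>(C, n, s). max n (s - 1), \<lambda>(C, n, s). if n < s - 1 then Suc s else s]")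
     auto

text \<open>
  The companion vectors, with the same shift: \<open>gj_comp C n s\<close> is $E^{(s-1)}_n$.
\<close>

function gj_comp :: "'a::field rfmat \<Rightarrow> nat \<Rightarrow> nat \<Rightarrow> 'a finseq" where
  "gj_comp C n 0 = unit_vec n"
| "gj_comp C n (Suc i) =
    (if i < n then
       (if gj C i n \<noteq> 0
        then gj_comp C n i - scale (Poly_Mapping.lookup (gj C n i) (pivot (gj C i n))) (gj_comp C i n)
        else gj_comp C n i)
     else if i = n then
       (if gj C n n \<noteq> 0
        then scale (inverse (Poly_Mapping.lookup (gj C n n) (pivot (gj C n n)))) (gj_comp C n n)
        else gj_comp C n n)
     else
       (if gj C i (Suc i) \<noteq> 0
        then gj_comp C n i - scale (Poly_Mapping.lookup (gj C n i) (pivot (gj C i (Suc i)))) (gj_comp C i (Suc i))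
        else gj_comp C n i))"
  by pat_completeness auto
termination
  by (relation "measures [\<lambda>(C, n, s). max n (s - 1), \<lambda>(C, n, s). if n < s - 1 then Suc s else s]")
     auto

text \<open>The first stage $M_k \geq k$ from which on row \<open>k\<close> no longer changes.\<close>

definition gj_stable :: "'a::field rfmat \<Rightarrow> nat \<Rightarrow> nat" where
  "gj_stable C k = (LEAST m. k \<le> m \<and> (\<forall>n\<ge>m. gj C k (Suc n) = gj C k (Suc m)))"

definition gj_limit :: "'a::field rfmat \<Rightarrow> 'a rfmat" where
  "gj_limit C k = gj C k (Suc (gj_stable C k))"

definition gj_companion :: "'a::field rfmat \<Rightarrow> 'a rfmat" where
  "gj_companion C k = gj_comp C k (Suc (gj_stable C k))"

end

theory Submission
  imports Defs
begin

text \<open>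
  Everything follows from one fact: the companion sequence is a basis of the space of
  all finitely supported sequences (\<open>bij_comb_gj_companion\<close>). Indeed the companion vectors
  record the row operations, so taking the combination of the rows of \<open>C\<close> with coefficients
  \<open>gj_companion C k\<close> gives the limit row \<open>gj_limit C k\<close> (\<open>comb_gj_companion\<close>). A basis, written
  as a matrix, has a row-finite inverse; so the limit matrix is an invertible matrix times
  \<open>C\<close>, which gives the row equivalence and the equality of the row spaces. Vectors of
  distinct lengths are independent, and a combination of them has the length of one of them
  (\<open>distinct_pivots_complete_basis\<close>); as the nonzero limit rows have distinct pivots, they
  form a complete basis of row-length.

  After finitely many stages the companion vectors are obtained from the canonical
  basis by invertible operations, so those of the first \<open>n\<close> rows are a basis of the span of
  the first \<open>n\<close> unit vectors. What has to be controlled is the passage to the limit, since at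
  no stage need all treated rows be final. Two properties of the rows treated so far are
  decisive. They are in reduced form: a nonzero row has entry \<open>1\<close> at its pivot, and the other
  rows have entry \<open>0\<close> there (\<open>reduced_upto\<close>). And Jordan elimination neither kills a row
  nor moves its pivot (\<open>jordan_preserves_pivot\<close>), since a multiple of the new row is
  subtracted from a row only if the pivot of the new row is the smaller one. The pivots
  are distinct, so this happens only finitely often to a given row.

  Independence survives the limit, because a linear relation involves finitely many vectors
  and these are all final at some stage. For spanning, expand \<open>unit_vec m\<close> in the companion
  vectors of a late stage. Applying the same combination to the rows shows that the
  coefficient of a nonzero row is the entry of \<open>C m\<close> at its pivot. So the only nonzero rows
  that contribute have their pivot in the support of \<open>C m\<close>; there are finitely many, and
  they are final at a late enough stage. Companions of zero rows are final from the
  start (\<open>unit_vec_in_span_gj_companion\<close>).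
\<close>

section \<open>Vectors with distinct pivots\<close>

lemma pivot_eq_Max: "x \<noteq> 0 \<Longrightarrow> pivot x = Max (Poly_Mapping.keys x)"
  by (simp add: pivot_def len_def)

lemma len_eq_pivot: "x \<noteq> 0 \<Longrightarrow> len x = int (pivot x)"
  by (simp add: pivot_def len_def)

lemma lookup_pivot: "x \<noteq> 0 \<Longrightarrow> Poly_Mapping.lookup x (pivot x) \<noteq> 0"
  using Max_in[of "Poly_Mapping.keys x"] by (simp add: pivot_eq_Max in_keys_iff)

lemma le_pivot:
  assumes "Poly_Mapping.lookup x j \<noteq> 0"
  shows "j \<le> pivot x"
proof -
  have "x \<noteq> 0" using assms by auto
  then show ?thesis using assms by (simp add: pivot_eq_Max in_keys_iff)
qed

lemma pivot_eqI:
  assumes "Poly_Mapping.lookup x p \<noteq> 0" "\<And>j. p < j \<Longrightarrow> Poly_Mapping.lookup x j = 0"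
  shows "pivot x = p"
proof -
  have "x \<noteq> 0" using assms by auto
  then show ?thesis using assms(2)[of "pivot x"] le_pivot[OF assms(1)] lookup_pivot[of x] by force
qed

lemma lookup_sum_scale:
  "Poly_Mapping.lookup (\<Sum>k\<in>S. scale (a k) (b k)) j = (\<Sum>k\<in>S. a k * Poly_Mapping.lookup (b k) j)"
  by (induction S rule: infinite_finite_induct) (auto simp: lookup_add)

lemma pivot_combination:
  assumes F: "0 \<notin> F" "inj_on pivot F"
    and t: "finite t" "t \<subseteq> F" "t \<noteq> {}" "\<And>v. v \<in> t \<Longrightarrow> u v \<noteq> 0"
  shows "\<exists>v\<in>t. (\<Sum>v\<in>t. scale (u v) v) \<noteq> 0 \<and> pivot (\<Sum>v\<in>t. scale (u v) v) = pivot v"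
proof -
  let ?s = "\<Sum>v\<in>t. scale (u v) v"
  \<comment> \<open>The vector with the largest pivot cannot be cancelled at that pivot.\<close>
  obtain v where v: "v \<in> t" "\<And>w. w \<in> t \<Longrightarrow> pivot w \<le> pivot v"
    using t Max_in[of "pivot ` t"] Max_ge[of "pivot ` t"]
    by (metis (no_types, lifting) finite_imageI imageE image_eqI image_is_empty)
  have small: "Poly_Mapping.lookup w j = 0" if "w \<in> t" "pivot v < j" for w j
    using le_pivot[of w j] v(2)[OF that(1)] that(2) by force
  have "Poly_Mapping.lookup w (pivot v) = 0" if "w \<in> t - {v}" for w
    using le_pivot[of w "pivot v"] v(2)[of w] inj_onD[OF F(2), of w v] t(2) v(1) that by force
  then have "Poly_Mapping.lookup ?s (pivot v) = u v * Poly_Mapping.lookup v (pivot v)"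
    unfolding lookup_sum_scale using t(1) v(1) by (subst sum.remove[of _ v]) auto
  then have nz: "Poly_Mapping.lookup ?s (pivot v) \<noteq> 0"
    using lookup_pivot[of v] F(1) t(2,4) v(1) by auto
  moreover have "Poly_Mapping.lookup ?s j = 0" if "pivot v < j" for j
    using small that by (simp add: lookup_sum_scale)
  ultimately have "pivot ?s = pivot v" by (rule pivot_eqI)
  moreover have "?s \<noteq> 0" using nz by auto
  ultimately show ?thesis using v(1) by blast
qed

text \<open>
  A combination with nonzero coefficients inherits the pivot of one of its vectors, so it is
  nonzero, which is independence, and its length already occurs in \<open>F\<close>.
\<close>

lemma distinct_pivots_complete_basis:
  assumes F: "0 \<notin> F" "inj_on pivot F"
  shows "complete_length_basis F (finseq.span F)"
proof -
  have "finseq.independent F"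
  proof
    assume "finseq.dependent F"
    then obtain t u v where t: "finite t" "t \<subseteq> F" "(\<Sum>v\<in>t. scale (u v) v) = 0" "v \<in> t" "u v \<noteq> 0"
      by (auto simp: finseq.dependent_explicit)
    let ?t = "{v \<in> t. u v \<noteq> 0}"
    have "(\<Sum>v\<in>?t. scale (u v) v) = (\<Sum>v\<in>t. scale (u v) v)"
      using t(1) by (intro sum.mono_neutral_left) auto
    moreover have "finite ?t" "?t \<subseteq> F" "?t \<noteq> {}" using t(1,2,4,5) by auto
    then have "(\<Sum>v\<in>?t. scale (u v) v) \<noteq> 0"
      using pivot_combination[OF F, of ?t u] by blast
    ultimately show False using t(3) by simp
  qed
  moreover have "lengths (finseq.span F) \<subseteq> lengths F"
  proof
    fix l assume "l \<in> lengths (finseq.span F)"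
    then obtain x where x: "x \<in> finseq.span F" "x \<noteq> 0" "l = len x"
      by (auto simp: lengths_def)
    then obtain t u where t: "finite t" "t \<subseteq> F" "x = (\<Sum>v\<in>t. scale (u v) v)"
      by (auto simp: finseq.span_explicit)
    let ?t = "{v \<in> t. u v \<noteq> 0}"
    have xt: "x = (\<Sum>v\<in>?t. scale (u v) v)"
      using t by (auto intro!: sum.mono_neutral_right)
    then have "?t \<noteq> {}" using x(2) by force
    moreover have "finite ?t" "?t \<subseteq> F" using t(1,2) by auto
    ultimately have "\<exists>v\<in>?t. x \<noteq> 0 \<and> pivot x = pivot v"
      unfolding xt by (intro pivot_combination[OF F]) auto
    then obtain v where v: "v \<in> F" "pivot x = pivot v" using t(2) by auto
    then have "v \<noteq> 0" using F(1) by auto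
    then have "l = len v" "v \<in> F - {0}" using v x(2,3) by (simp_all add: len_eq_pivot)
    then show "l \<in> lengths F" unfolding lengths_def by (rule image_eqI)
  qed
  moreover have "lengths F \<subseteq> lengths (finseq.span F)"
    by (auto simp: lengths_def intro: finseq.span_base)
  ultimately show ?thesis
    by (auto simp: complete_length_basis_def is_basis_def)
qed


section \<open>Linear combinations of the rows of a matrix\<close>

text \<open>
  The product of the row vector \<open>x\<close> with the matrix \<open>b\<close>. As a function of \<open>x\<close> it is the linear
  map sending the unit vectors to the rows of \<open>b\<close>, so the family \<open>b\<close> is a basis exactly when
  \<open>comb b\<close> is bijective. This form of the basis property speaks of families, not of sets of
  vectors, and also yields the inverse matrix.
\<close>

definition comb :: "'a::field rfmat \<Rightarrow> 'a finseq \<Rightarrow> 'a finseq" where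
  "comb b x = (\<Sum>k\<in>Poly_Mapping.keys x. scale (Poly_Mapping.lookup x k) (b k))"

lemma rf_mult_eq_comb: "rf_mult A B = (\<lambda>n. comb B (A n))"
  by (simp add: rf_mult_def comb_def)

lemma comb_superset:
  assumes "finite S" "Poly_Mapping.keys x \<subseteq> S"
  shows "comb b x = (\<Sum>k\<in>S. scale (Poly_Mapping.lookup x k) (b k))"
  unfolding comb_def using assms
  by (intro sum.mono_neutral_left) (auto simp: in_keys_iff)

lemma linear_comb: "Vector_Spaces.linear scale scale (comb b)"
proof
  fix x y :: "'a finseq" and c :: 'a
  let ?S = "Poly_Mapping.keys x \<union> Poly_Mapping.keys y"
  have "comb b (x + y) = (\<Sum>k\<in>?S. scale (Poly_Mapping.lookup (x + y) k) (b k))"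
    by (rule comb_superset) (auto simp: Poly_Mapping.keys_add)
  also have "\<dots> = (\<Sum>k\<in>?S. scale (Poly_Mapping.lookup x k) (b k))
      + (\<Sum>k\<in>?S. scale (Poly_Mapping.lookup y k) (b k))"
    by (simp add: lookup_add finseq.scale_left_distrib sum.distrib)
  also have "\<dots> = comb b x + comb b y"
    by (simp add: comb_superset[of ?S])
  finally show "comb b (x + y) = comb b x + comb b y" .
  have "comb b (scale c x) = (\<Sum>k\<in>Poly_Mapping.keys x. scale (Poly_Mapping.lookup (scale c x) k) (b k))"
    by (rule comb_superset) (auto simp: in_keys_iff)
  then show "comb b (scale c x) = scale c (comb b x)"
    by (simp add: comb_def finseq.scale_sum_right)
qed

global_interpretation finseq_pair: vector_space_pair
  "scale :: 'a::field \<Rightarrow> 'a finseq \<Rightarrow> 'a finseq" "scale :: 'a::field \<Rightarrow> 'a finseq \<Rightarrow> 'a finseq"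
  by unfold_locales

lemmas comb_diff = finseq_pair.linear_diff[OF linear_comb]
  and comb_scale = finseq_pair.linear_scale[OF linear_comb]
  and comb_sum = finseq_pair.linear_sum[OF linear_comb]

lemma lookup_unit_vec: "Poly_Mapping.lookup (unit_vec i) j = (if i = j then 1 else 0)"
  by (simp add: unit_vec_def lookup_single when_def)

lemma comb_unit_vec [simp]: "comb b (unit_vec k) = b k"
  by (subst comb_superset[of "{k}"]) (auto simp: in_keys_iff lookup_unit_vec split: if_splits)

lemma comb_of_unit_vecs [simp]: "comb unit_vec x = x"
proof (rule poly_mapping_eqI)
  fix j
  show "Poly_Mapping.lookup (comb unit_vec x) j = Poly_Mapping.lookup x j"
    by (auto simp: comb_def lookup_sum_scale lookup_unit_vec in_keys_iff if_distrib sum.delta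
        cong: if_cong)
qed

text \<open>
  Associativity of the matrix product, in terms of rows.
\<close>

lemma comb_comb: "comb b (comb A x) = comb (\<lambda>n. comb b (A n)) x"
  unfolding comb_def[of A] comb_sum comb_scale by (simp add: comb_def)

lemma range_comb: "range (comb b) = finseq.span (range b)"
proof
  show "range (comb b) \<subseteq> finseq.span (range b)"
    unfolding comb_def
    by (intro image_subsetI finseq.span_sum finseq.span_scale finseq.span_base rangeI)
  have "finseq.subspace (range (comb b))"
    using finseq_pair.linear_subspace_image[OF linear_comb finseq.subspace_UNIV] .
  moreover have "range b \<subseteq> range (comb b)"
    using comb_unit_vec[of b] by (metis image_subsetI rangeI)
  ultimately show "finseq.span (range b) \<subseteq> range (comb b)"
    by (intro finseq.span_minimal)
qed

lemma span_unit_vecs: "finseq.span (range unit_vec) = UNIV"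
  using range_comb[of unit_vec] by (metis comb_of_unit_vecs surjI)

lemma inj_unit_vec: "inj (unit_vec :: nat \<Rightarrow> 'a::field finseq)"
  by (rule injI) (metis lookup_unit_vec zero_neq_one)

lemma pivot_unit_vec: "pivot (unit_vec i) = i"
  by (rule pivot_eqI) (auto simp: lookup_unit_vec)

lemma independent_unit_vecs: "finseq.independent (range (unit_vec :: nat \<Rightarrow> 'a::field finseq))"
proof -
  have "unit_vec i \<noteq> (0 :: 'a finseq)" for i
    using lookup_unit_vec[of i i] by (metis lookup_zero zero_neq_one)
  moreover have "inj_on pivot (range (unit_vec :: nat \<Rightarrow> 'a finseq))"
    by (auto simp: inj_on_def pivot_unit_vec)
  ultimately show ?thesis
    using distinct_pivots_complete_basis[of "range (unit_vec :: nat \<Rightarrow> 'a finseq)"]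
    by (metis complete_length_basis_def is_basis_def imageE)
qed

lemma bij_comb_imp_basis_family:
  assumes "bij (comb b)"
  shows "is_basis_family b UNIV"
proof -
  have b: "b = comb b \<circ> unit_vec" by auto
  have inj: "inj (comb b)" using assms by (rule bij_is_inj)
  have "inj b"
    using inj inj_unit_vec by (subst b) (rule inj_compose)
  moreover have "finseq.independent (range b)"
    using finseq_pair.linear_independent_injective_image[OF linear_comb independent_unit_vecs, of b] inj
    by (simp add: image_image inj_on_subset)
  moreover have "finseq.span (range b) = UNIV"
    using assms by (simp add: range_comb[symmetric] bij_is_surj)
  ultimately show ?thesis by (simp add: is_basis_family_def is_basis_def)
qed

text \<open>
  The rows of the inverse of \<open>P\<close> are the preimages of the unit vectors under \<open>comb P\<close>; they are
  finitely supported simply because \<open>comb P\<close> is a map on finitely supported sequences.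
\<close>

lemma bij_comb_imp_row_equivalent:
  assumes "bij (comb P)"
  shows "row_equivalent (rf_mult P A) A"
proof -
  define Q where "Q = (\<lambda>n. inv (comb P) (unit_vec n))"
  have QP: "comb P (Q n) = unit_vec n" for n
    using assms by (simp add: Q_def bij_is_surj surj_f_inv_f)
  have "comb P (comb Q (P n)) = comb P (unit_vec n)" for n
    by (simp add: comb_comb QP)
  \<comment> \<open>Injectivity of \<open>comb P\<close> turns the one-sided inverse \<open>Q\<close> into a two-sided one.\<close>
  then have PQ: "comb Q (P n) = unit_vec n" for n
    using assms by (meson bij_is_inj injD)
  have "comb (rf_mult P A) (Q n) = A n" for n
    by (simp add: rf_mult_eq_comb QP flip: comb_comb)
  then show ?thesis
    unfolding row_equivalent_def
    by (intro exI[of _ Q] exI[of _ P]) (simp add: rf_mult_eq_comb QP PQ)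
qed


section \<open>One stage of the algorithm\<close>

declare gj.simps [simp del] gj_comp.simps [simp del]

text \<open>
  The multiple of the new row \<open>n\<close> that stage \<open>n\<close> subtracts from row \<open>i\<close>. The value \<open>0\<close> for a zero
  new row merges the two cases of the Jordan step into one formula. In the case of the
  companions it is needed, as the new companion vector is not zero when the new row is.
\<close>

definition jordan_coeff :: "'a::field rfmat \<Rightarrow> nat \<Rightarrow> nat \<Rightarrow> 'a" where
  "jordan_coeff C i n =
    (if gj C n (Suc n) = 0 then 0 else Poly_Mapping.lookup (gj C i n) (pivot (gj C n (Suc n))))"

lemma gj_jordan:
  "i < n \<Longrightarrow> gj C i (Suc n) = gj C i n - scale (jordan_coeff C i n) (gj C n (Suc n))"
  by (subst gj.simps(2)) (auto simp: jordan_coeff_def)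

lemma gj_comp_jordan:
  "i < n \<Longrightarrow> gj_comp C i (Suc n) = gj_comp C i n - scale (jordan_coeff C i n) (gj_comp C n (Suc n))"
  by (subst gj_comp.simps(2)) (auto simp: jordan_coeff_def)

text \<open>
  Each companion vector records how its row was obtained from the rows of \<open>C\<close>, because all
  operations are linear. The normalization of a zero row is no exception: the companion is
  kept, and the combination that it encodes is zero.
\<close>

lemma comb_gj_comp: "comb C (gj_comp C n s) = gj C n s"
  by (induction C n s rule: gj_comp.induct)
     (simp_all add: gj.simps gj_comp.simps comb_diff comb_scale)

text \<open>
  The invariant before stage \<open>n\<close>: with the shifted superscripts, \<open>gj C i n\<close> for \<open>i < n\<close> are the
  rows that stage \<open>n\<close> finds already treated.
\<close>

definition reduced_upto :: "'a::field rfmat \<Rightarrow> nat \<Rightarrow> bool" where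
  "reduced_upto C n \<longleftrightarrow> (\<forall>i<n. gj C i n \<noteq> 0 \<longrightarrow>
    (\<forall>j<n. Poly_Mapping.lookup (gj C j n) (pivot (gj C i n)) = (if j = i then 1 else 0)))"

text \<open>
  Subtracting a multiple of the treated row \<open>i\<close> clears the pivot of row \<open>i\<close> and, since the
  treated rows are reduced, leaves alone the pivots that were cleared before.
\<close>

lemma gauss_clears_pivots:
  assumes "reduced_upto C n"
  shows "i \<le> n \<Longrightarrow> j < i \<Longrightarrow> gj C j n \<noteq> 0 \<Longrightarrow> Poly_Mapping.lookup (gj C n i) (pivot (gj C j n)) = 0"
proof (induction i)
  case (Suc i)
  then have "i < n" "j < n" by auto
  show ?case
  proof (cases "j = i")
    case True
    then show ?thesis using assms Suc.prems \<open>i < n\<close>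
      by (simp add: gj.simps reduced_upto_def lookup_minus)
  next
    case False
    then show ?thesis using assms Suc \<open>i < n\<close> \<open>j < n\<close>
      by (simp add: gj.simps reduced_upto_def lookup_minus)
  qed
qed simp

lemma gj_normalized:
  assumes "gj C n (Suc n) \<noteq> 0"
  shows "Poly_Mapping.lookup (gj C n (Suc n)) (pivot (gj C n (Suc n))) = 1"
proof -
  let ?x = "gj C n n" and ?c = "inverse (Poly_Mapping.lookup (gj C n n) (pivot (gj C n n)))"
  have x: "?x \<noteq> 0" "gj C n (Suc n) = scale ?c ?x"
    using assms by (auto simp: gj.simps(2) split: if_splits)
  have one: "Poly_Mapping.lookup (gj C n (Suc n)) (pivot ?x) = 1"
    using lookup_pivot[OF x(1)] x(2) by simp
  moreover have "pivot (gj C n (Suc n)) = pivot ?x"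
    using one le_pivot[of ?x] x(2) by (intro pivot_eqI) force+
  ultimately show ?thesis by simp
qed

lemma new_row_clears_pivots:
  assumes "reduced_upto C n" "j < n" "gj C j n \<noteq> 0"
  shows "Poly_Mapping.lookup (gj C n (Suc n)) (pivot (gj C j n)) = 0"
  using gauss_clears_pivots[OF assms(1) le_refl assms(2,3)] by (simp add: gj.simps(2))

text \<open>
  The new row vanishes at the pivot of row \<open>i\<close>, so this entry survives. If a nonzero multiple of
  the new row is subtracted, then row \<open>i\<close> has a nonzero entry at the pivot of the new row,
  which is therefore not beyond the pivot of row \<open>i\<close>; so nothing is created beyond it.
\<close>

lemma jordan_preserves_pivot:
  assumes red: "reduced_upto C n" and i: "i < n" "gj C i n \<noteq> 0"
  shows "gj C i (Suc n) \<noteq> 0" "pivot (gj C i (Suc n)) = pivot (gj C i n)"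
proof -
  let ?p = "pivot (gj C i n)"
  have nz: "Poly_Mapping.lookup (gj C i (Suc n)) ?p \<noteq> 0"
    using new_row_clears_pivots[OF red i] lookup_pivot[OF i(2)] gj_jordan[OF i(1), of C]
    by (simp add: lookup_minus)
  then show "gj C i (Suc n) \<noteq> 0" by auto
  have "Poly_Mapping.lookup (gj C i (Suc n)) j = 0" if j: "?p < j" for j
  proof -
    have ij: "Poly_Mapping.lookup (gj C i n) j = 0"
      using le_pivot[of "gj C i n" j] j by force
    have "Poly_Mapping.lookup (gj C n (Suc n)) j = 0" if "jordan_coeff C i n \<noteq> 0"
    proof -
      have "pivot (gj C n (Suc n)) \<le> ?p"
        using that le_pivot by (auto simp: jordan_coeff_def split: if_splits)
      then show ?thesis using le_pivot[of "gj C n (Suc n)" j] j by force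
    qed
    then show ?thesis using ij gj_jordan[OF i(1), of C] by (auto simp: lookup_minus)
  qed
  with nz show "pivot (gj C i (Suc n)) = ?p" by (rule pivot_eqI)
qed

lemma jordan_coeff_zero_row: "gj C i n = 0 \<Longrightarrow> jordan_coeff C i n = 0"
  by (simp add: jordan_coeff_def)

lemma reduced_upto: "reduced_upto C n"
proof (induction n)
  case 0
  show ?case by (simp add: reduced_upto_def)
next
  case (Suc n)
  let ?G = "gj C n (Suc n)"
  show ?case
    unfolding reduced_upto_def
  proof (intro allI impI)
    fix i j assume i: "i < Suc n" "gj C i (Suc n) \<noteq> 0" and j: "j < Suc n"
    show "Poly_Mapping.lookup (gj C j (Suc n)) (pivot (gj C i (Suc n))) = (if j = i then 1 else 0)"
    proof (cases "i = n")
      case True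
      then show ?thesis using i j gj_normalized[of C n] gj_jordan[of j n C]
        by (cases "j = n") (auto simp: lookup_minus jordan_coeff_def)
    next
      case False
      then have in': "i < n" using i by simp
      have nz: "gj C i n \<noteq> 0"
        using i(2) gj_jordan[OF in', of C] jordan_coeff_zero_row[of C i n] by auto
      note G = new_row_clears_pivots[OF Suc in' nz]
      show ?thesis
        using G Suc in' nz j gj_jordan[of j n C]
        by (cases "j = n") (auto simp: jordan_preserves_pivot(2)[OF Suc in' nz] lookup_minus reduced_upto_def)
    qed
  qed
qed


section \<open>Stabilization\<close>

text \<open>
  Whether row \<open>k\<close> is zero, and where its pivot lies, is settled once row \<open>k\<close> has been
  normalized; hence \<open>gj C k (Suc k)\<close> serves below as the reference for both.
\<close>

lemma gj_persistent:
  assumes "k < n"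
  shows "gj C k n = 0 \<longleftrightarrow> gj C k (Suc k) = 0"
    and "gj C k (Suc k) \<noteq> 0 \<Longrightarrow> pivot (gj C k n) = pivot (gj C k (Suc k))"
proof -
  have "(gj C k n = 0 \<longleftrightarrow> gj C k (Suc k) = 0) \<and>
      (gj C k (Suc k) \<noteq> 0 \<longrightarrow> pivot (gj C k n) = pivot (gj C k (Suc k)))"
    using Suc_leI[OF assms]
  proof (induction n rule: dec_induct)
    case (step m)
    then have "k < m" by simp
    then show ?case
      using step jordan_preserves_pivot[OF reduced_upto \<open>k < m\<close>, of C]
        gj_jordan[of k m C] jordan_coeff_zero_row[of C k m]
      by auto
  qed simp
  then show "gj C k n = 0 \<longleftrightarrow> gj C k (Suc k) = 0"
    and "gj C k (Suc k) \<noteq> 0 \<Longrightarrow> pivot (gj C k n) = pivot (gj C k (Suc k))" by auto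
qed

lemma lookup_gj_pivot:
  assumes "i < n" "j < n" "gj C i (Suc i) \<noteq> 0"
  shows "Poly_Mapping.lookup (gj C j n) (pivot (gj C i (Suc i))) = (if j = i then 1 else 0)"
  using reduced_upto[of C n] gj_persistent[OF assms(1), of C] assms
  unfolding reduced_upto_def by metis

lemma inj_on_row_pivot: "inj_on (\<lambda>k. pivot (gj C k (Suc k))) {k. gj C k (Suc k) \<noteq> 0}"
proof (rule inj_onI)
  fix i j
  assume ij: "i \<in> {k. gj C k (Suc k) \<noteq> 0}" "j \<in> {k. gj C k (Suc k) \<noteq> 0}"
    "pivot (gj C i (Suc i)) = pivot (gj C j (Suc j))"
  define n where "n = Suc (max i j)"
  have "i < n" "j < n" by (auto simp: n_def)
  then show "i = j"
    using lookup_gj_pivot[of i n i C] lookup_gj_pivot[of j n i C] ij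
    by (auto split: if_splits)
qed

lemma finite_rows_with_pivot_in:
  assumes "finite P"
  shows "finite {k. gj C k (Suc k) \<noteq> 0 \<and> pivot (gj C k (Suc k)) \<in> P}"
  using finite_vimage_IntI[OF assms inj_on_row_pivot[of C]]
  by (rule rev_finite_subset) auto

text \<open>
  Row \<open>k\<close> changes in a later stage \<open>n\<close> only if the pivot of row \<open>n\<close> is at most that of row \<open>k\<close>. As
  distinct rows have distinct pivots, there are finitely many such \<open>n\<close>.
\<close>

lemma gj_eventually_stable: "\<exists>m\<ge>k. \<forall>n\<ge>m. gj C k (Suc n) = gj C k (Suc m)"
proof -
  let ?K = "{n. gj C n (Suc n) \<noteq> 0 \<and> pivot (gj C n (Suc n)) \<in> {..pivot (gj C k (Suc k))}}"
  obtain b where b: "\<And>n. n \<in> ?K \<Longrightarrow> n \<le> b"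
    using finite_nat_set_iff_bounded_le[of ?K] finite_rows_with_pivot_in[of "{..pivot (gj C k (Suc k))}" C]
    by auto
  define m where "m = max k b"
  have step: "gj C k (Suc n) = gj C k n" if "m < n" for n
  proof -
    have "k < n" "n \<notin> ?K" using b[of n] that by (auto simp: m_def)
    have "jordan_coeff C k n = 0"
    proof (rule ccontr)
      assume nz: "jordan_coeff C k n \<noteq> 0"
      then have "pivot (gj C n (Suc n)) \<le> pivot (gj C k n)" "gj C n (Suc n) \<noteq> 0" "gj C k n \<noteq> 0"
        using le_pivot by (auto simp: jordan_coeff_def split: if_splits)
      then show False
        using gj_persistent[OF \<open>k < n\<close>, of C] \<open>n \<notin> ?K\<close> by simp
    qed
    then show ?thesis using gj_jordan[OF \<open>k < n\<close>, of C] by simp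
  qed
  have "gj C k (Suc n) = gj C k (Suc m)" if "m \<le> n" for n
    using that by (induction n rule: dec_induct) (auto simp: step)
  moreover have "k \<le> m" by (simp add: m_def)
  ultimately show ?thesis by blast
qed

lemma gj_stable:
  shows "k \<le> gj_stable C k" and "gj_stable C k < n \<Longrightarrow> gj C k n = gj_limit C k"
proof -
  have *: "k \<le> gj_stable C k \<and> (\<forall>n\<ge>gj_stable C k. gj C k (Suc n) = gj C k (Suc (gj_stable C k)))"
    unfolding gj_stable_def by (rule LeastI_ex) (use gj_eventually_stable[of k C] in blast)
  then show "k \<le> gj_stable C k" by blast
  show "gj C k n = gj_limit C k" if "gj_stable C k < n"
  proof (cases n)
    case (Suc n')
    then show ?thesis using *[THEN conjunct2, rule_format, of n'] that by (simp add: gj_limit_def)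
  qed (use that in simp)
qed

text \<open>
  If a later stage leaves row \<open>k\<close> unchanged, then it subtracts the zero multiple of the new row, or the
  new row is zero; in both cases \<open>jordan_coeff\<close> is \<open>0\<close> and the companion is unchanged too.
\<close>

lemma gj_comp_stable:
  assumes "gj_stable C k < n"
  shows "gj_comp C k n = gj_companion C k"
  using Suc_leI[OF assms]
proof (induction n rule: dec_induct)
  case (step n)
  then have n: "k < n" "gj_stable C k < n"
    using gj_stable(1)[of k C] by auto
  have "scale (jordan_coeff C k n) (gj C n (Suc n)) = 0"
    using gj_jordan[OF n(1), of C] gj_stable(2)[of C k n] gj_stable(2)[of C k "Suc n"] n(2) by simp
  then have "jordan_coeff C k n = 0"
    by (auto simp: jordan_coeff_def)
  then show ?case using step gj_comp_jordan[OF n(1), of C] by simp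
qed (simp add: gj_companion_def)

lemma gj_stable_zero_row:
  assumes "gj C k (Suc k) = 0"
  shows "gj_stable C k = k"
proof -
  have "gj C k (Suc n) = 0" if "k \<le> n" for n
    using gj_persistent(1)[of k "Suc n" C] that assms by simp
  then show ?thesis
    unfolding gj_stable_def by (intro Least_equality) auto
qed

lemma comb_gj_companion: "comb C (gj_companion C k) = gj_limit C k"
  by (simp add: gj_companion_def gj_limit_def comb_gj_comp)

lemma gj_limit_distinct_pivots: "inj_on pivot (range (gj_limit C) - {0})"
proof (rule inj_onI)
  fix x y assume x: "x \<in> range (gj_limit C) - {0}" and y: "y \<in> range (gj_limit C) - {0}"
    and eq: "pivot x = pivot y"
  have row: "gj C k (Suc k) \<noteq> 0 \<and> pivot (gj_limit C k) = pivot (gj C k (Suc k))"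
    if "gj_limit C k \<noteq> 0" for k
    using gj_persistent[of k "Suc (gj_stable C k)" C] gj_stable(1)[of k C] that
    by (simp add: gj_limit_def)
  obtain i j where "x = gj_limit C i" "y = gj_limit C j" using x y by auto
  then show "x = y"
    using row[of i] row[of j] x y eq inj_onD[OF inj_on_row_pivot, of C i j] by auto
qed


section \<open>The companion vectors\<close>

abbreviation stage_span :: "'a::field rfmat \<Rightarrow> nat \<Rightarrow> 'a finseq set" where
  "stage_span C n \<equiv> finseq.span ((\<lambda>i. gj_comp C i n) ` {..<n})"

lemma gj_comp_gauss:
  "i \<le> n \<Longrightarrow> gj_comp C n i - unit_vec n \<in> stage_span C n"
proof (induction i)
  case 0
  then show ?case by (simp add: gj_comp.simps finseq.span_zero)
next
  case (Suc i)
  then have i: "i < n" "gj_comp C n i - unit_vec n \<in> stage_span C n" by auto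
  have "gj_comp C i n \<in> stage_span C n" using i by (auto intro: finseq.span_base)
  then have "gj_comp C n i - unit_vec n - scale c (gj_comp C i n) \<in> stage_span C n" for c
    using i(2) by (metis finseq.span_diff finseq.span_scale)
  then show ?case using i by (simp add: gj_comp.simps diff_right_commute)
qed

lemma gj_comp_normalize:
  obtains d where "d \<noteq> 0" "gj_comp C n (Suc n) = scale d (gj_comp C n n)"
proof (cases "gj C n n = 0")
  case True
  then show ?thesis using that[of 1] by (simp add: gj_comp.simps)
next
  case False
  then show ?thesis
    using that[of "inverse (Poly_Mapping.lookup (gj C n n) (pivot (gj C n n)))"] lookup_pivot[OF False]
    by (simp add: gj_comp.simps(2))
qed

text \<open>
  Stage by stage, the companions of the first \<open>n\<close> rows involve only the first \<open>n\<close> unit vectors,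
  and row \<open>n\<close> enters stage \<open>n\<close> with coordinate \<open>1\<close> at \<open>n\<close>. The two facts depend on each
  other.
\<close>

lemma gj_comp_support: "i < n \<Longrightarrow> n \<le> m \<Longrightarrow> Poly_Mapping.lookup (gj_comp C i n) m = 0"
  and gj_comp_new_row: "n \<le> m \<Longrightarrow>
    Poly_Mapping.lookup (gj_comp C n n) m = (if m = n then 1 else 0)"
proof -
  have new: "Poly_Mapping.lookup (gj_comp C n n) m = (if m = n then 1 else 0)"
    if old: "\<And>i m. i < n \<Longrightarrow> n \<le> m \<Longrightarrow> Poly_Mapping.lookup (gj_comp C i n) m = 0" and "n \<le> m" for n m
  proof -
    have "finseq.subspace {x :: 'a finseq. Poly_Mapping.lookup x m = 0}"
      by (auto simp: finseq.subspace_def lookup_add)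
    then have "stage_span C n \<subseteq> {x. Poly_Mapping.lookup x m = 0}"
      using old[OF _ \<open>n \<le> m\<close>] by (intro finseq.span_minimal) auto
    then have "Poly_Mapping.lookup (gj_comp C n n - unit_vec n) m = 0"
      using gj_comp_gauss[of n n C] by auto
    then show ?thesis by (auto simp: lookup_minus lookup_unit_vec)
  qed
  have old: "i < n \<Longrightarrow> n \<le> m \<Longrightarrow> Poly_Mapping.lookup (gj_comp C i n) m = 0" for i n m
  proof (induction n arbitrary: i m)
    case (Suc n)
    obtain d where d: "gj_comp C n (Suc n) = scale d (gj_comp C n n)"
      using gj_comp_normalize by blast
    have "Poly_Mapping.lookup (gj_comp C n n) m = 0"
      using new[of n m] Suc by auto
    then show ?case
      using Suc d gj_comp_jordan[of i n C] by (cases "i = n") (auto simp: lookup_minus)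
  qed simp
  show "i < n \<Longrightarrow> n \<le> m \<Longrightarrow> Poly_Mapping.lookup (gj_comp C i n) m = 0" by (rule old)
  show "n \<le> m \<Longrightarrow> Poly_Mapping.lookup (gj_comp C n n) m = (if m = n then 1 else 0)"
    by (rule new[OF old])
qed

text \<open>
  Undo the Jordan step of stage \<open>n\<close> in a linear relation: it becomes a relation between
  the companions of the previous stage and the new one with coefficient \<open>?s\<close>. Only the new one has
  a nonzero coordinate at \<open>n\<close>, so \<open>?s = 0\<close> and the induction hypothesis applies.
\<close>

lemma gj_comp_independent:
  "(\<Sum>i<n. scale (a i) (gj_comp C i n)) = 0 \<Longrightarrow> i < n \<Longrightarrow> a i = 0"
proof (induction n arbitrary: a i)
  case (Suc n)
  let ?E = "gj_comp C n (Suc n)" and ?s = "a n - (\<Sum>i<n. a i * jordan_coeff C i n)"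
  obtain d where d: "d \<noteq> 0" "?E = scale d (gj_comp C n n)"
    using gj_comp_normalize by blast
  have "(\<Sum>i<n. scale (a i) (gj_comp C i (Suc n)))
      = (\<Sum>i<n. scale (a i) (gj_comp C i n) - scale (a i * jordan_coeff C i n) ?E)"
    by (intro sum.cong) (auto simp: gj_comp_jordan finseq.scale_right_diff_distrib)
  also have "\<dots> = (\<Sum>i<n. scale (a i) (gj_comp C i n)) - scale (\<Sum>i<n. a i * jordan_coeff C i n) ?E"
    by (simp add: sum_subtractf finseq.scale_sum_left)
  finally have "(\<Sum>i<n. scale (a i) (gj_comp C i n)) + scale ?s ?E
      = (\<Sum>i<n. scale (a i) (gj_comp C i (Suc n))) + scale (a n) ?E"
    by (simp add: finseq.scale_left_diff_distrib)
  then have eq: "(\<Sum>i<n. scale (a i) (gj_comp C i n)) + scale ?s ?E = 0"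
    using Suc.prems(1) by simp
  then have "Poly_Mapping.lookup ((\<Sum>i<n. scale (a i) (gj_comp C i n)) + scale ?s ?E) n = 0"
    by simp
  then have "?s * d = 0"
    by (simp add: lookup_add lookup_sum_scale gj_comp_support d(2) gj_comp_new_row)
  then have s: "?s = 0" using d(1) by simp
  then have "(\<Sum>i<n. scale (a i) (gj_comp C i n)) = 0" using eq by simp
  then have "a i = 0" if "i < n" for i using Suc.IH[of a] that by blast
  moreover from this have "a n = 0" using s by simp
  ultimately show ?case using Suc.prems(2) by (auto simp: less_Suc_eq)
qed simp

text \<open>
  The elementary operations are reversible, so the span of the companions contains that
  of the previous stage and, from the new row, also \<open>unit_vec n\<close>.
\<close>

lemma unit_vec_in_stage_span: "m < n \<Longrightarrow> unit_vec m \<in> stage_span C n"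
proof (induction n)
  case (Suc n)
  let ?E = "gj_comp C n (Suc n)"
  have E: "?E \<in> stage_span C (Suc n)" by (auto intro: finseq.span_base)
  have "gj_comp C i n \<in> stage_span C (Suc n)" if "i < n" for i
  proof -
    have "gj_comp C i (Suc n) \<in> stage_span C (Suc n)"
      using that by (auto intro: finseq.span_base)
    then have "gj_comp C i (Suc n) + scale (jordan_coeff C i n) ?E \<in> stage_span C (Suc n)"
      using E by (intro finseq.span_add finseq.span_scale)
    then show ?thesis using gj_comp_jordan[OF that, of C] by simp
  qed
  then have mono: "stage_span C n \<subseteq> stage_span C (Suc n)"
    by (intro finseq.span_minimal) auto
  show ?case
  proof (cases "m = n")
    case False
    then show ?thesis using Suc mono by auto
  next
    case True
    obtain d where d: "d \<noteq> 0" "?E = scale d (gj_comp C n n)"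
      using gj_comp_normalize by blast
    have "scale (inverse d) ?E - (gj_comp C n n - unit_vec n) \<in> stage_span C (Suc n)"
      using gj_comp_gauss[of n n C] mono
      by (intro finseq.span_diff[OF finseq.span_scale[OF E]]) auto
    then show ?thesis using d True by simp
  qed
qed simp

lemma span_finite_family:
  assumes "x \<in> finseq.span (f ` {..<n::nat})"
  obtains a where "x = (\<Sum>i<n. scale (a i) (f i))"
proof -
  have "\<exists>a. x = (\<Sum>i<n. scale (a i) (f i))"
    using assms
  proof (induction rule: finseq.span_induct_alt)
    case base
    show ?case by (rule exI[of _ "\<lambda>_. 0"]) simp
  next
    case (step c v y)
    then obtain k a where k: "k < n" "v = f k" "y = (\<Sum>i<n. scale (a i) (f i))" by auto
    have "scale c v = (\<Sum>i<n. scale (if i = k then c else 0) (f i))"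
      using k by (subst sum.remove[of _ k]) auto
    then have "scale c v + y = (\<Sum>i<n. scale ((if i = k then c else 0) + a i) (f i))"
      using k by (simp add: finseq.scale_left_distrib sum.distrib)
    then show ?case by (rule exI[of _ "\<lambda>i. (if i = k then c else 0) + a i"])
  qed
  then show ?thesis using that by blast
qed

text \<open>
  A linear relation between companion vectors involves finitely many of them, and these
  are all final at some common stage \<open>n\<close>.
\<close>

lemma inj_comb_gj_companion: "inj (comb (gj_companion C))"
proof -
  have "x = 0" if x: "comb (gj_companion C) x = 0" for x
  proof -
    obtain n where n: "\<forall>s \<in> gj_stable C ` Poly_Mapping.keys x. s < n"
      using finite_nat_set_iff_bounded[of "gj_stable C ` Poly_Mapping.keys x"] by auto
    then have sub: "Poly_Mapping.keys x \<subseteq> {..<n}"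
      using gj_stable(1)[of _ C] by (fastforce intro: le_less_trans)
    have "(\<Sum>i<n. scale (Poly_Mapping.lookup x i) (gj_comp C i n))
        = (\<Sum>i<n. scale (Poly_Mapping.lookup x i) (gj_companion C i))"
      using n gj_comp_stable[of C _ n] by (intro sum.cong) (auto simp: in_keys_iff)
    also have "\<dots> = 0" using x comb_superset[OF _ sub] by simp
    finally have "Poly_Mapping.lookup x i = 0" if "i < n" for i
      using gj_comp_independent[of "Poly_Mapping.lookup x" C n i] that by blast
    moreover have "Poly_Mapping.lookup x i = 0" if "\<not> i < n" for i
      using sub that by (auto simp: in_keys_iff)
    ultimately show "x = 0" by (intro poly_mapping_eqI) auto
  qed
  then show ?thesis
    unfolding finseq_pair.linear_inj_iff_eq_0[OF linear_comb] by (intro allI impI)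
qed

text \<open>
  The heart of the passage to the limit: the expansion of \<open>unit_vec m\<close> at a stage \<open>n\<close> uses
  companions of nonzero rows only for those with a pivot in the support of \<open>C m\<close>. This finite set \<open>?K\<close>
  does not depend on \<open>n\<close>, so \<open>n\<close> can be chosen such that all its rows are final.
\<close>

lemma unit_vec_in_span_gj_companion: "unit_vec m \<in> finseq.span (range (gj_companion C))"
proof -
  let ?K = "{k. gj C k (Suc k) \<noteq> 0 \<and> pivot (gj C k (Suc k)) \<in> Poly_Mapping.keys (C m)}"
  have "finite (insert m (gj_stable C ` ?K))"
    by (simp add: finite_rows_with_pivot_in)
  then obtain n where "\<forall>s \<in> insert m (gj_stable C ` ?K). s < n"
    using finite_nat_set_iff_bounded by blast
  then have n: "m < n" "\<And>k. k \<in> ?K \<Longrightarrow> gj_stable C k < n" by auto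
  obtain a where a: "unit_vec m = (\<Sum>i<n. scale (a i) (gj_comp C i n))"
    using span_finite_family[OF unit_vec_in_stage_span[OF n(1), of C]] .
  have "comb C (unit_vec m) = (\<Sum>i<n. scale (a i) (gj C i n))"
    unfolding a by (simp add: comb_sum comb_scale comb_gj_comp)
  then have Cm: "C m = (\<Sum>i<n. scale (a i) (gj C i n))" by simp
  \<comment> \<open>The rows are reduced, so the entry of a combination at a pivot is the coefficient.\<close>
  have coeff: "a k = Poly_Mapping.lookup (C m) (pivot (gj C k (Suc k)))"
    if "k < n" "gj C k (Suc k) \<noteq> 0" for k
    using that by (simp add: Cm lookup_sum_scale lookup_gj_pivot if_distrib sum.delta cong: if_cong)
  have "scale (a k) (gj_comp C k n) \<in> finseq.span (range (gj_companion C))" if k: "k < n" for k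
  proof (cases "a k = 0")
    case True
    then show ?thesis by (simp add: finseq.span_zero)
  next
    case False
    \<comment> \<open>A zero row is final from stage \<open>k\<close> on; a nonzero row with \<open>a k \<noteq> 0\<close> lies in \<open>?K\<close>.\<close>
    have "gj_stable C k < n"
      using n(2)[of k] coeff[OF k] False k gj_stable_zero_row[of C k]
      by (cases "gj C k (Suc k) = 0") (auto simp: in_keys_iff)
    then show ?thesis
      by (auto simp: gj_comp_stable intro: finseq.span_scale finseq.span_base)
  qed
  then show ?thesis unfolding a by (intro finseq.span_sum) auto
qed

lemma bij_comb_gj_companion: "bij (comb (gj_companion C))"
proof -
  have "finseq.span (range unit_vec) \<subseteq> finseq.span (range (gj_companion C))"
    using unit_vec_in_span_gj_companion by (intro finseq.span_minimal) auto
  then have "surj (comb (gj_companion C))"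
    by (simp add: range_comb span_unit_vecs top.extremum_unique)
  then show ?thesis using inj_comb_gj_companion by (simp add: bij_def)
qed

section \<open>The Gauss-Jordan theorem\<close>

lemma row_space_gj_limit: "row_space (gj_limit C) = row_space C"
proof -
  have "comb (gj_limit C) = comb C \<circ> comb (gj_companion C)"
    by (auto simp: comb_comb comb_gj_companion)
  then have "range (comb (gj_limit C)) = comb C ` range (comb (gj_companion C))"
    by (simp only: image_comp)
  also have "\<dots> = range (comb C)"
    by (simp add: bij_is_surj[OF bij_comb_gj_companion])
  finally show ?thesis by (simp add: range_comb row_space_def)
qed

theorem proposition38:
  fixes C :: "'a::field rfmat"
  shows "complete_length_basis (range (gj_limit C) - {0}) (row_space C)
    \<and> row_equivalent (gj_limit C) C
    \<and> is_basis_family (gj_companion C) UNIV"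
proof (intro conjI)
  have "finseq.span (range (gj_limit C) - {0}) = row_space C"
    using row_space_gj_limit[of C] by (simp add: row_space_def finseq.span_delete_0)
  then show "complete_length_basis (range (gj_limit C) - {0}) (row_space C)"
    using distinct_pivots_complete_basis[OF _ gj_limit_distinct_pivots, of C] by simp
  have "rf_mult (gj_companion C) C = gj_limit C"
    by (simp add: rf_mult_eq_comb comb_gj_companion)
  then show "row_equivalent (gj_limit C) C"
    using bij_comb_imp_row_equivalent[OF bij_comb_gj_companion, of C C] by simp
  show "is_basis_family (gj_companion C) UNIV"
    by (rule bij_comb_imp_basis_family[OF bij_comb_gj_companion])
qed

end
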